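(* Let $(X,\|\cdot\|)$ be a Banach space and $S$ a nonempty closed bounded subset of $X$. The following statements are equivalent: (i) for every $x^*\in X^*$, the function $\tfrac12\|\cdot\|^2+x^*$ attains a strong maximum over $S$; (ii) $S$ is a singleton.
   Context: $X$ is a (real) Banach space with topological dual $X^*$. A function $g:X\to\mathbb{R}$ attains a strong maximum over $S$ if it has a maximum point $\bar x\in S$ over $S$ and every sequence $(x_n)$ in $S$ with $g(x_n)\to\sup_S g$ converges in norm to $\bar x$. The function in (i) is $x\mapsto\tfrac12\|x\|^2+x^*(x)$. *)

theory Defs
  imports "HOL-Analysis.Analysis"
begin

definition attains_strong_maximum :: "('a::metric_space \<Rightarrow> real) \<Rightarrow> 'a set \<Rightarrow> bool" where
  "attains_strong_maximum g S \<longleftrightarrow>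
     (\<exists>x\<in>S. (\<forall>y\<in>S. g y \<le> g x) \<and>
        (\<forall>u::nat \<Rightarrow> 'a. (\<forall>n. u n \<in> S) \<and> (\<lambda>n. g (u n)) \<longlonglongrightarrow> (SUP y\<in>S. g y)
            \<longrightarrow> u \<longlonglongrightarrow> x))"

end

theory Submission
  imports Defs
begin

text \<open>
  For a functional \<open>f\<close> let \<open>h f\<close> be the supremum of \<open>(1/2) * (norm x)\<^sup>2 + f x\<close> over \<open>x \<in> S\<close>
  (\<open>conj_sup\<close> below). The Fenchel-Young inequality \<open>- f x \<le> (1/2) * (norm f)\<^sup>2 + (1/2) * (norm x)\<^sup>2\<close>
  shows that \<open>F f = (1/2) * (norm f)\<^sup>2 + h f\<close> is nonnegative. If \<open>F f \<le> 0\<close> for some \<open>f\<close>, then that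
  inequality is an equality at every point of \<open>S\<close>, so \<open>(1/2) * (norm x)\<^sup>2 + f x\<close> is constant on
  \<open>S\<close>; a strong maximum point is the only maximum point, and \<open>S\<close> is a singleton. It
  remains to find a zero of \<open>F\<close>.

  The function \<open>F\<close> is convex, coercive and weak-star lower semicontinuous on the dual, so by the
  Banach-Alaoglu theorem it has a minimiser \<open>f\<close> (\<open>minimiser_exists\<close>). Since the maximum of
  \<open>(1/2) * (norm x)\<^sup>2 + f x\<close> over \<open>S\<close> is strong, say at \<open>z\<close>, the convex function \<open>h\<close> is
  differentiable at \<open>f\<close> and its derivative is evaluation at \<open>z\<close>. Replacing \<open>h\<close> by its
  linearisation, \<open>f\<close> also minimises \<open>(1/2) * (norm f')\<^sup>2 + f' z\<close> over all functionals \<open>f'\<close>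
  (\<open>first_order_at_minimiser\<close>). By the Hahn-Banach theorem some \<open>f'\<close> has norm at most
  \<open>norm z\<close> and \<open>f' z = - (norm z)\<^sup>2\<close>, so that minimum is at most \<open>- (1/2) * (norm z)\<^sup>2\<close>,
  which says \<open>F f \<le> 0\<close>.
\<close>

section \<open>The Hahn-Banach theorem for sublinear functionals\<close>

definition sublinear :: "('a::real_vector \<Rightarrow> real) \<Rightarrow> bool" where
  "sublinear p \<longleftrightarrow> (\<forall>x y. p (x + y) \<le> p x + p y) \<and> (\<forall>c x. 0 \<le> c \<longrightarrow> p (c *\<^sub>R x) = c * p x)"

lemma sublinear_add: "sublinear p \<Longrightarrow> p (x + y) \<le> p x + p y"
  by (simp add: sublinear_def)

lemma sublinear_scale: "sublinear p \<Longrightarrow> 0 \<le> c \<Longrightarrow> p (c *\<^sub>R x) = c * p x"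
  by (simp add: sublinear_def)

lemma sublinear_zero: "sublinear p \<Longrightarrow> p 0 = 0"
  using sublinear_scale[of p 0 0] by simp

lemma sublinear_minus_lower:
  assumes "sublinear p"
  shows "- p (- x) \<le> p x"
  using sublinear_add[OF assms, of x "- x"] sublinear_zero[OF assms] by simp

text \<open>
  Applied to \<open>1 / c\<close>, the one-sided bound yields its own converse; infima need only be
  estimated from one side.
\<close>

lemma sublinear_scale_le:
  fixes p :: "'a::real_vector \<Rightarrow> real"
  assumes "\<And>c x. 0 < c \<Longrightarrow> p (c *\<^sub>R x) \<le> c * p x" and "p 0 = 0" and "0 \<le> c"
  shows "p (c *\<^sub>R x) = c * p x"
proof (cases "c = 0")
  case False
  with assms(3) have "0 < c" by simp
  have "p ((1 / c) *\<^sub>R (c *\<^sub>R x)) \<le> (1 / c) * p (c *\<^sub>R x)"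
    using \<open>0 < c\<close> by (intro assms(1)) simp
  then have "p x \<le> p (c *\<^sub>R x) / c"
    using \<open>0 < c\<close> by simp
  then have "c * p x \<le> p (c *\<^sub>R x)"
    using \<open>0 < c\<close> by (simp add: field_simps)
  with assms(1)[OF \<open>0 < c\<close>, of x] show ?thesis by simp
qed (simp add: assms(2))

text \<open>
  This is the largest sublinear functional below \<open>p\<close> whose value at \<open>- x\<close> is at most \<open>- p x\<close>.
  A linear functional below it therefore agrees with \<open>p\<close> at \<open>x\<close>.
\<close>

definition tilt :: "('a::real_vector \<Rightarrow> real) \<Rightarrow> 'a \<Rightarrow> 'a \<Rightarrow> real" where
  "tilt p x y = (INF t\<in>{0..}. p (y + t *\<^sub>R x) - t * p x)"

lemma tilt_bdd_below:
  assumes "sublinear p"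
  shows "bdd_below ((\<lambda>t. p (y + t *\<^sub>R x) - t * p x) ` {0..})"
proof (rule bdd_belowI2)
  fix t :: real assume "t \<in> {0..}"
  then have "t * p x = p (t *\<^sub>R x)" using sublinear_scale[OF assms] by simp
  also have "\<dots> \<le> p (y + t *\<^sub>R x) + p (- y)"
    using sublinear_add[OF assms, of "y + t *\<^sub>R x" "- y"] by simp
  finally show "- p (- y) \<le> p (y + t *\<^sub>R x) - t * p x" by simp
qed

lemma tilt_le:
  assumes "sublinear p" "0 \<le> t"
  shows "tilt p x y \<le> p (y + t *\<^sub>R x) - t * p x"
  unfolding tilt_def by (rule cINF_lower[OF tilt_bdd_below]) (use assms in auto)

lemma tilt_greatest:
  assumes "\<And>t. 0 \<le> t \<Longrightarrow> c \<le> p (y + t *\<^sub>R x) - t * p x"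
  shows "c \<le> tilt p x y"
  unfolding tilt_def by (rule cINF_greatest) (use assms in auto)

lemma tilt_le_self: "sublinear p \<Longrightarrow> tilt p x y \<le> p y"
  using tilt_le[of p 0 x y] by simp

lemma tilt_minus_le: "sublinear p \<Longrightarrow> tilt p x (- x) \<le> - p x"
  using tilt_le[of p 1 x "- x"] by (simp add: sublinear_zero)

lemma sublinear_tilt:
  assumes p: "sublinear p"
  shows "sublinear (tilt p x)"
  unfolding sublinear_def
proof (intro conjI allI impI)
  fix y z
  have "tilt p x (y + z) - (p (z + s *\<^sub>R x) - s * p x) \<le> tilt p x y" if "0 \<le> s" for s
  proof (rule tilt_greatest)
    fix t :: real assume "0 \<le> t"
    have "tilt p x (y + z) \<le> p ((y + z) + (t + s) *\<^sub>R x) - (t + s) * p x"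
      using that \<open>0 \<le> t\<close> by (intro tilt_le[OF p]) simp
    also have "p ((y + z) + (t + s) *\<^sub>R x) \<le> p (y + t *\<^sub>R x) + p (z + s *\<^sub>R x)"
      using sublinear_add[OF p, of "y + t *\<^sub>R x" "z + s *\<^sub>R x"] by (simp add: algebra_simps)
    finally show "tilt p x (y + z) - (p (z + s *\<^sub>R x) - s * p x) \<le> p (y + t *\<^sub>R x) - t * p x"
      by (simp add: algebra_simps)
  qed
  then have "tilt p x (y + z) - tilt p x y \<le> tilt p x z"
    by (intro tilt_greatest) (smt (verit))
  then show "tilt p x (y + z) \<le> tilt p x y + tilt p x z" by simp
next
  fix c :: real and y assume "0 \<le> c"
  show "tilt p x (c *\<^sub>R y) = c * tilt p x y"
  proof (rule sublinear_scale_le[OF _ _ \<open>0 \<le> c\<close>])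
    fix c :: real and y assume "0 < c"
    have "tilt p x (c *\<^sub>R y) / c \<le> tilt p x y"
    proof (rule tilt_greatest)
      fix t :: real assume "0 \<le> t"
      have "tilt p x (c *\<^sub>R y) \<le> p (c *\<^sub>R y + (c * t) *\<^sub>R x) - (c * t) * p x"
        using \<open>0 < c\<close> \<open>0 \<le> t\<close> by (intro tilt_le[OF p]) simp
      also have "p (c *\<^sub>R y + (c * t) *\<^sub>R x) = c * p (y + t *\<^sub>R x)"
        using sublinear_scale[OF p, of c "y + t *\<^sub>R x"] \<open>0 < c\<close> by (simp add: algebra_simps)
      finally show "tilt p x (c *\<^sub>R y) / c \<le> p (y + t *\<^sub>R x) - t * p x"
        using \<open>0 < c\<close> by (simp add: field_simps)
    qed
    then show "tilt p x (c *\<^sub>R y) \<le> c * tilt p x y"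
      using \<open>0 < c\<close> by (simp add: field_simps)
  next
    have "0 \<le> tilt p x 0"
      by (rule tilt_greatest) (simp add: sublinear_scale[OF p])
    with tilt_le_self[OF p, of x 0] show "tilt p x 0 = 0"
      by (simp add: sublinear_zero[OF p])
  qed
qed

text \<open>
  A chain is directed downwards, so two near-optimal members of \<open>C\<close> at different points can be
  replaced by one; this is what makes the infimum subadditive. The common bound \<open>p\<close> keeps the
  infimum finite, since \<open>q y \<ge> - q (- y) \<ge> - p (- y)\<close>.
\<close>

lemma sublinear_INF_chain:
  assumes ne: "C \<noteq> {}" and sub: "\<And>q. q \<in> C \<Longrightarrow> sublinear q \<and> q \<le> p"
    and chain: "\<And>q r. q \<in> C \<Longrightarrow> r \<in> C \<Longrightarrow> q \<le> r \<or> r \<le> q"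
  shows "sublinear (\<lambda>y. INF q\<in>C. q y)" and "\<And>q y. q \<in> C \<Longrightarrow> (INF q\<in>C. q y) \<le> q y"
proof -
  have bdd: "bdd_below ((\<lambda>q. q y) ` C)" for y
  proof (rule bdd_belowI2)
    fix q assume "q \<in> C"
    then show "- p (- y) \<le> q y"
      using sub[of q] sublinear_minus_lower[of q y] le_funD[of q p "- y"] by force
  qed
  show low: "(INF q\<in>C. q y) \<le> q y" if "q \<in> C" for q y
    by (rule cINF_lower[OF bdd that])
  show "sublinear (\<lambda>y. INF q\<in>C. q y)"
    unfolding sublinear_def
  proof (intro conjI allI impI)
    fix x y
    have *: "(INF q\<in>C. q (x + y)) \<le> q x + r y" if "q \<in> C" "r \<in> C" for q r
    proof -
      note qr = that
      obtain s where s: "s \<in> C" "s \<le> q" "s \<le> r"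
        using chain[OF qr] qr by blast
      have "(INF q\<in>C. q (x + y)) \<le> s (x + y)" by (rule low[OF s(1)])
      also have "\<dots> \<le> s x + s y" using sub[OF s(1)] by (simp add: sublinear_add)
      also have "\<dots> \<le> q x + r y" using s by (simp add: le_funD add_mono)
      finally show ?thesis .
    qed
    have "(INF q\<in>C. q (x + y)) - r y \<le> (INF q\<in>C. q x)" if "r \<in> C" for r
      by (rule cINF_greatest[OF ne]) (use * that in force)
    then have "(INF q\<in>C. q (x + y)) - (INF q\<in>C. q x) \<le> (INF q\<in>C. q y)"
      by (intro cINF_greatest[OF ne]) force
    then show "(INF q\<in>C. q (x + y)) \<le> (INF q\<in>C. q x) + (INF q\<in>C. q y)" by simp
  next
    fix c :: real and x assume "0 \<le> c"
    show "(INF q\<in>C. q (c *\<^sub>R x)) = c * (INF q\<in>C. q x)"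
    proof (rule sublinear_scale_le[where p = "\<lambda>y. INF q\<in>C. q y", OF _ _ \<open>0 \<le> c\<close>])
      fix c :: real and x assume "0 < c"
      have "(INF q\<in>C. q (c *\<^sub>R x)) / c \<le> (INF q\<in>C. q x)"
      proof (rule cINF_greatest[OF ne])
        fix q assume "q \<in> C"
        with low[OF this, of "c *\<^sub>R x"] sub[OF this] \<open>0 < c\<close>
        show "(INF q\<in>C. q (c *\<^sub>R x)) / c \<le> q x"
          by (simp add: sublinear_scale field_simps)
      qed
      then show "(INF q\<in>C. q (c *\<^sub>R x)) \<le> c * (INF q\<in>C. q x)"
        using \<open>0 < c\<close> by (simp add: field_simps)
    next
      show "(INF q\<in>C. q 0) = 0" using sub ne by (simp add: sublinear_zero)
    qed
  qed
qed

lemma minimal_sublinear_exists: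
  assumes "sublinear p"
  shows "\<exists>q. sublinear q \<and> q \<le> p \<and> (\<forall>r. sublinear r \<longrightarrow> r \<le> q \<longrightarrow> r = q)"
proof -
  let ?A = "{q. sublinear q \<and> q \<le> p}"
  have "\<exists>q\<in>?A. \<forall>r\<in>?A. r \<le> q \<longrightarrow> r = q"
  proof (rule predicate_Zorn[where P = "\<lambda>q r. r \<le> q"])
    show "partial_order_on ?A (relation_of (\<lambda>q r. r \<le> q) ?A)"
      by (rule partial_order_on_relation_ofI) auto
  next
    fix C assume C: "C \<in> Chains (relation_of (\<lambda>q r. r \<le> q) ?A)"
    then have sub: "\<And>q. q \<in> C \<Longrightarrow> sublinear q \<and> q \<le> p"
      and chain: "\<And>q r. q \<in> C \<Longrightarrow> r \<in> C \<Longrightarrow> q \<le> r \<or> r \<le> q"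
      by (auto simp: Chains_def relation_of_def)
    show "\<exists>u\<in>?A. \<forall>q\<in>C. u \<le> q"
    proof (cases "C = {}")
      case True
      then show ?thesis using assms by auto
    next
      case False
      have inf: "sublinear (\<lambda>y. INF q\<in>C. q y)" "\<And>q y. q \<in> C \<Longrightarrow> (INF q\<in>C. q y) \<le> q y"
        by (rule sublinear_INF_chain[OF False, of p]; use sub chain in blast)+
      from False obtain q where "q \<in> C" by blast
      have le: "(\<lambda>y. INF q\<in>C. q y) \<le> r" if "r \<in> C" for r
        using inf(2)[OF that] by (simp add: le_fun_def)
      have "(\<lambda>y. INF q\<in>C. q y) \<in> ?A"
        using inf(1) le[OF \<open>q \<in> C\<close>] sub[OF \<open>q \<in> C\<close>] by (auto intro: order_trans)
      with le show ?thesis by blast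
    qed
  qed
  then show ?thesis by (metis (mono_tags, lifting) mem_Collect_eq order_trans)
qed

text \<open>
  Minimality forces \<open>tilt q x = q\<close> for each \<open>x\<close>, hence \<open>q (- x) \<le> - q x\<close>; an odd sublinear
  functional is linear.
\<close>

lemma minimal_sublinear_linear:
  assumes q: "sublinear q" and min: "\<And>r. sublinear r \<Longrightarrow> r \<le> q \<Longrightarrow> r = q"
  shows "linear q"
proof -
  have neg: "q (- x) = - q x" for x
  proof -
    have "tilt q x = q"
      by (rule min[OF sublinear_tilt[OF q]]) (simp add: le_fun_def tilt_le_self[OF q])
    then have "q (- x) \<le> - q x" using tilt_minus_le[OF q, of x] by simp
    with sublinear_minus_lower[OF q, of x] show ?thesis by simp
  qed
  show ?thesis
  proof (rule linearI)
    fix x y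
    have "q (- x + - y) \<le> q (- x) + q (- y)" by (rule sublinear_add[OF q])
    then have "q x + q y \<le> q (x + y)" using neg[of "x + y"] by (simp add: neg)
    with sublinear_add[OF q, of x y] show "q (x + y) = q x + q y" by simp
  next
    fix c x
    show "q (c *\<^sub>R x) = c *\<^sub>R q x"
    proof (cases "0 \<le> c")
      case False
      then have "q ((- c) *\<^sub>R x) = (- c) * q x" by (intro sublinear_scale[OF q]) simp
      then show ?thesis using neg[of "c *\<^sub>R x"] by simp
    qed (simp add: sublinear_scale[OF q])
  qed
qed

text \<open>
  Starting the descent at \<open>tilt p x\<close> rather than at \<open>p\<close> forces equality at \<open>x\<close>, so that no
  extension from a subspace has to be considered.
\<close>

theorem hahn_banach_sublinear:
  assumes p: "sublinear p"
  shows "\<exists>g. linear g \<and> (\<forall>y. g y \<le> p y) \<and> g x = p x"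
proof -
  obtain q where q: "sublinear q" "q \<le> tilt p x" and min: "\<And>r. sublinear r \<Longrightarrow> r \<le> q \<Longrightarrow> r = q"
    using minimal_sublinear_exists[OF sublinear_tilt[OF p, of x]] by blast
  have lin: "linear q" using q(1) min by (rule minimal_sublinear_linear)
  have le: "q y \<le> p y" for y
    using le_funD[OF q(2), of y] tilt_le_self[OF p, of x y] by simp
  have "q (- x) \<le> - p x"
    using le_funD[OF q(2), of "- x"] tilt_minus_le[OF p, of x] by simp
  then have "q x = p x" using linear_neg[OF lin, of x] le[of x] by simp
  with lin le show ?thesis by blast
qed

lemma norming_functional_exists:
  fixes x :: "'a::real_normed_vector"
  shows "\<exists>f :: 'a \<Rightarrow>\<^sub>L real. norm f \<le> 1 \<and> blinfun_apply f x = norm x"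
proof -
  have "sublinear (norm :: 'a \<Rightarrow> real)"
    by (simp add: sublinear_def norm_triangle_ineq)
  from hahn_banach_sublinear[OF this, of x]
  obtain g where g: "linear g" "\<And>y. g y \<le> norm y" "g x = norm x" by blast
  have abs: "\<bar>g y\<bar> \<le> norm y" for y
    using g(2)[of y] g(2)[of "- y"] linear_neg[OF g(1), of y] by simp
  have bl: "bounded_linear g"
    using abs by (intro bounded_linear_intro[where K = 1])
      (simp_all add: linear_add[OF g(1)] linear_scale[OF g(1)])
  show ?thesis
    using abs g(3) bl
    by (intro exI[of _ "Blinfun g"]) (auto simp: bounded_linear_Blinfun_apply intro!: norm_blinfun_bound)
qed

section \<open>Weak-star compactness of dual balls\<close>

lemma compact_imp_closed_fun:
  fixes A :: "('a \<Rightarrow> 'b::metric_space) set"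
  assumes "compact A"
  shows "closed A"
proof -
  have "Hausdorff_space (euclidean :: ('a \<Rightarrow> 'b) topology)"
    unfolding euclidean_product_topology[symmetric]
    by (simp add: Hausdorff_space_product_topology Hausdorff_space_euclidean)
  from compactin_imp_closedin[OF this] assms show ?thesis by simp
qed

text \<open>
  Functionals are identified with their underlying functions, so that the weak-star topology becomes
  the product topology on functions. The ball is cut out of a product of compact intervals by the linearity equations, each of which
  involves finitely many coordinates and so defines a closed set.
\<close>

theorem banach_alaoglu:
  "compact (blinfun_apply ` {f :: 'a::real_normed_vector \<Rightarrow>\<^sub>L real. norm f \<le> R})"
proof (cases "0 \<le> R")
  case False
  then have "{f :: 'a \<Rightarrow>\<^sub>L real. norm f \<le> R} = {}"
    by (auto simp: not_le intro: less_le_trans)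
  then show ?thesis by simp
next
  case True
  let ?P = "PiE UNIV (\<lambda>x::'a. {- (R * norm x)..R * norm x})"
  let ?L = "(\<Inter>x y. {g. g (x + y) = g x + g y}) \<inter> (\<Inter>c x. {g :: 'a \<Rightarrow> real. g (c *\<^sub>R x) = c * g x})"
  have coord [continuous_intros]: "continuous_on UNIV (\<lambda>g :: 'a \<Rightarrow> real. g x)" for x
    by (rule continuous_on_product_coordinates)
  have "compact ?P"
    unfolding compactin_euclidean_iff[symmetric] euclidean_product_topology[symmetric]
    by (simp add: compactin_PiE)
  moreover have "closed ?L"
    by (intro closed_Int closed_INT ballI closed_Collect_eq continuous_intros)
  ultimately have "compact (?P \<inter> ?L)" by (rule compact_Int_closed)
  also have "?P \<inter> ?L = blinfun_apply ` {f :: 'a \<Rightarrow>\<^sub>L real. norm f \<le> R}"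
  proof (intro equalityI subsetI)
    fix g assume "g \<in> ?P \<inter> ?L"
    then have g: "\<And>x. \<bar>g x\<bar> \<le> norm x * R" "\<And>x y. g (x + y) = g x + g y" "\<And>c x. g (c *\<^sub>R x) = c * g x"
      by (auto simp: PiE_iff abs_le_iff mult.commute minus_le_iff)
    then have "bounded_linear g" by (intro bounded_linear_intro[where K = R]) auto
    then show "g \<in> blinfun_apply ` {f. norm f \<le> R}"
      using g(1) True
      by (intro image_eqI[of _ _ "Blinfun g"])
        (auto simp: bounded_linear_Blinfun_apply mult.commute intro!: norm_blinfun_bound)
  next
    fix g :: "'a \<Rightarrow> real" assume "g \<in> blinfun_apply ` {f. norm f \<le> R}"
    then obtain f :: "'a \<Rightarrow>\<^sub>L real" where f: "g = blinfun_apply f" "norm f \<le> R" by blast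
    have "\<bar>f x\<bar> \<le> R * norm x" for x
      using norm_blinfun[of f x] mult_right_mono[OF f(2), of "norm x"] by simp
    then show "g \<in> ?P \<inter> ?L"
      by (simp add: f(1) PiE_iff abs_le_iff minus_le_iff blinfun.add_right blinfun.scaleR_right)
  qed
  finally show ?thesis .
qed

section \<open>Minimising the conjugate plus half the squared dual norm\<close>

lemma half_norm_sq_ge:
  fixes f :: "'a::real_normed_vector \<Rightarrow>\<^sub>L real"
  shows "f u \<le> (1/2) * (norm f)\<^sup>2 + (1/2) * (norm u)\<^sup>2"
proof -
  have "f u \<le> norm f * norm u" using norm_blinfun[of f u] by simp
  then show ?thesis using zero_le_power2[of "norm f - norm u"]
    by (simp add: power2_diff)
qed

text \<open>
  Half the squared dual norm is the Fenchel conjugate of half the squared norm, hence a supremum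
  of functions of \<open>f\<close> that depend on a single value of \<open>f\<close>. This is what makes it weak-star lower
  semicontinuous.
\<close>

lemma half_norm_sq_le_iff:
  fixes f :: "'a::real_normed_vector \<Rightarrow>\<^sub>L real"
  shows "(1/2) * (norm f)\<^sup>2 \<le> a \<longleftrightarrow> (\<forall>u. f u - (1/2) * (norm u)\<^sup>2 \<le> a)"
proof
  assume "(1/2) * (norm f)\<^sup>2 \<le> a"
  then show "\<forall>u. f u - (1/2) * (norm u)\<^sup>2 \<le> a"
    using half_norm_sq_ge[of f] by (smt (verit))
next
  assume le: "\<forall>u. f u - (1/2) * (norm u)\<^sup>2 \<le> a"
  from le[rule_format, of 0] have "0 \<le> a" by (simp add: blinfun.zero_right)
  have "norm f \<le> sqrt (2 * a)"
  proof (rule norm_blinfun_bound)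
    fix u
    show "norm (f u) \<le> sqrt (2 * a) * norm u"
    proof (cases "u = 0")
      case False
      \<comment> \<open>this multiple of \<open>u\<close> maximises the left-hand side of the hypothesis along the line through \<open>u\<close>\<close>
      define t where "t = f u / (norm u)\<^sup>2"
      have "f (t *\<^sub>R u) - (1/2) * (norm (t *\<^sub>R u))\<^sup>2 = (f u)\<^sup>2 / (2 * (norm u)\<^sup>2)"
        using False by (simp add: t_def blinfun.scaleR_right power_mult_distrib field_simps power2_eq_square)
      with le[rule_format, of "t *\<^sub>R u"] have "(f u)\<^sup>2 / (2 * (norm u)\<^sup>2) \<le> a" by simp
      then have "(f u)\<^sup>2 \<le> (2 * a) * (norm u)\<^sup>2" using False by (simp add: field_simps)
      then have "sqrt ((f u)\<^sup>2) \<le> sqrt ((2 * a) * (norm u)\<^sup>2)" by (rule real_sqrt_le_mono)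
      then show ?thesis by (simp add: real_sqrt_mult)
    qed (simp add: blinfun.zero_right)
  qed (use \<open>0 \<le> a\<close> in simp)
  then have "(norm f)\<^sup>2 \<le> (sqrt (2 * a))\<^sup>2" by (rule power_mono) simp
  then show "(1/2) * (norm f)\<^sup>2 \<le> a" using \<open>0 \<le> a\<close> by simp
qed

text \<open>
  This is the Fenchel conjugate of the function equal to \<open>- (1/2) * (norm x)\<^sup>2\<close> on \<open>S\<close> and to
  infinity elsewhere. In a Hilbert space, where \<open>f\<close> is the inner product with a vector, it
  is half the squared farthest distance from the negative of that vector to \<open>S\<close>, minus
  \<open>(1/2) * (norm f)\<^sup>2\<close>.
\<close>

definition conj_sup :: "'a::real_normed_vector set \<Rightarrow> ('a \<Rightarrow>\<^sub>L real) \<Rightarrow> real" where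
  "conj_sup S f = (SUP x\<in>S. (1/2) * (norm x)\<^sup>2 + f x)"

lemma conj_sup_bdd_above:
  fixes f :: "'a::real_normed_vector \<Rightarrow>\<^sub>L real"
  assumes "bounded S"
  shows "bdd_above ((\<lambda>x. (1/2) * (norm x)\<^sup>2 + f x) ` S)"
proof -
  obtain B where B: "\<And>x. x \<in> S \<Longrightarrow> norm x \<le> B"
    using assms by (auto simp: bounded_iff)
  show ?thesis
  proof (rule bdd_aboveI2)
    fix x assume "x \<in> S"
    have "(norm x)\<^sup>2 \<le> B\<^sup>2" using B[OF \<open>x \<in> S\<close>] by (simp add: power_mono)
    with half_norm_sq_ge[of f x]
    show "(1/2) * (norm x)\<^sup>2 + f x \<le> (1/2) * (norm f)\<^sup>2 + B\<^sup>2" by simp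
  qed
qed

lemma conj_sup_le_iff:
  fixes f :: "'a::real_normed_vector \<Rightarrow>\<^sub>L real"
  assumes "S \<noteq> {}" "bounded S"
  shows "conj_sup S f \<le> c \<longleftrightarrow> (\<forall>x\<in>S. (1/2) * (norm x)\<^sup>2 + f x \<le> c)"
  unfolding conj_sup_def by (rule cSUP_le_iff[OF assms(1) conj_sup_bdd_above[OF assms(2)]])

lemma conj_sup_upper:
  fixes f :: "'a::real_normed_vector \<Rightarrow>\<^sub>L real"
  assumes "bounded S" "x \<in> S"
  shows "(1/2) * (norm x)\<^sup>2 + f x \<le> conj_sup S f"
  unfolding conj_sup_def by (rule cSUP_upper[OF assms(2) conj_sup_bdd_above[OF assms(1)]])

text \<open>
  The right-hand side is a family of non-strict inequalities between values of \<open>f\<close> at points,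
  so it defines a closed set in the topology of pointwise convergence.
\<close>

lemma sublevel_iff:
  fixes f :: "'a::real_normed_vector \<Rightarrow>\<^sub>L real"
  assumes "S \<noteq> {}" "bounded S"
  shows "(1/2) * (norm f)\<^sup>2 + conj_sup S f \<le> c \<longleftrightarrow>
    (\<forall>x\<in>S. \<forall>u. f u - (1/2) * (norm u)\<^sup>2 \<le> c - ((1/2) * (norm x)\<^sup>2 + f x))"
proof -
  have "(1/2) * (norm f)\<^sup>2 + conj_sup S f \<le> c \<longleftrightarrow> conj_sup S f \<le> c - (1/2) * (norm f)\<^sup>2" by auto
  also have "\<dots> \<longleftrightarrow> (\<forall>x\<in>S. (1/2) * (norm f)\<^sup>2 \<le> c - ((1/2) * (norm x)\<^sup>2 + f x))"
    unfolding conj_sup_le_iff[OF assms] by (intro ball_cong) auto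
  finally show ?thesis unfolding half_norm_sq_le_iff .
qed

text \<open>
  Coercivity: a single point \<open>x\<close> of \<open>S\<close> bounds the objective from below by
  \<open>norm f * ((1/2) * norm f - norm x)\<close>.
\<close>

lemma sublevel_norm_bound:
  fixes f :: "'a::real_normed_vector \<Rightarrow>\<^sub>L real"
  assumes "bounded S" "x \<in> S" "(1/2) * (norm f)\<^sup>2 + conj_sup S f \<le> c"
  shows "norm f \<le> 2 * norm x + 2 * \<bar>c\<bar> + 1"
proof (rule ccontr)
  assume "\<not> ?thesis"
  then have large: "1 \<le> norm f" "\<bar>c\<bar> + 1/2 < (1/2) * norm f - norm x"
    using norm_ge_zero[of x] by linarith+
  have "- (norm f * norm x) \<le> f x" using norm_blinfun[of f x] by (simp add: abs_le_iff)
  then have "norm f * ((1/2) * norm f - norm x) \<le> (1/2) * (norm f)\<^sup>2 + ((1/2) * (norm x)\<^sup>2 + f x)"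
    by (simp add: algebra_simps power2_eq_square)
  also have "\<dots> \<le> c" using conj_sup_upper[OF assms(1,2), of f] assms(3) by simp
  finally have "norm f * ((1/2) * norm f - norm x) \<le> c" .
  moreover have "1 * ((1/2) * norm f - norm x) \<le> norm f * ((1/2) * norm f - norm x)"
    using large by (intro mult_right_mono) auto
  ultimately show False using large by simp
qed

lemma compact_sublevel:
  fixes S :: "'a::real_normed_vector set"
  assumes "S \<noteq> {}" "bounded S"
  shows "compact (blinfun_apply ` {f. (1/2) * (norm f)\<^sup>2 + conj_sup S f \<le> c})"
proof -
  obtain x0 where "x0 \<in> S" using assms(1) by blast
  define R where "R = 2 * norm x0 + 2 * \<bar>c\<bar> + 1"
  let ?C = "\<Inter>x\<in>S. \<Inter>u. {g. g u - (1/2) * (norm u)\<^sup>2 \<le> c - ((1/2) * (norm x)\<^sup>2 + g x)}"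
  have coord [continuous_intros]: "continuous_on UNIV (\<lambda>g :: 'a \<Rightarrow> real. g x)" for x
    by (rule continuous_on_product_coordinates)
  have "closed ?C"
    by (intro closed_INT ballI closed_Collect_le continuous_intros)
  then have "compact (blinfun_apply ` {f. norm f \<le> R} \<inter> ?C)"
    by (rule compact_Int_closed[OF banach_alaoglu])
  also have "blinfun_apply ` {f. norm f \<le> R} \<inter> ?C
      = blinfun_apply ` {f. (1/2) * (norm f)\<^sup>2 + conj_sup S f \<le> c}"
    using sublevel_norm_bound[OF assms(2) \<open>x0 \<in> S\<close>, of _ c, folded R_def]
    unfolding sublevel_iff[OF assms] by blast
  finally show ?thesis .
qed

text \<open>
  A minimiser is a common point of all the sublevel sets at attained levels. These are compact,
  and finitely many of them share the best of the finitely many functionals that define them.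
\<close>

lemma minimiser_exists:
  fixes S :: "'a::real_normed_vector set"
  assumes "S \<noteq> {}" "bounded S"
  shows "\<exists>f. \<forall>f'. (1/2) * (norm f)\<^sup>2 + conj_sup S f \<le> (1/2) * (norm f')\<^sup>2 + conj_sup S f'"
proof -
  let ?F = "\<lambda>f :: 'a \<Rightarrow>\<^sub>L real. (1/2) * (norm f)\<^sup>2 + conj_sup S f"
  let ?A = "\<lambda>f'. blinfun_apply ` {f. ?F f \<le> ?F f'}"
  have "?A 0 \<inter> (\<Inter>f'\<in>UNIV. ?A f') \<noteq> {}"
  proof (rule compact_imp_fip_image)
    show "compact (?A 0)" by (rule compact_sublevel[OF assms])
    show "closed (?A f')" for f' by (rule compact_imp_closed_fun[OF compact_sublevel[OF assms]])
    fix I :: "('a \<Rightarrow>\<^sub>L real) set" assume "finite I"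
    define m where "m = arg_min_on ?F (insert 0 I)"
    have "?F m \<le> ?F f'" if "f' \<in> insert 0 I" for f'
      unfolding m_def using \<open>finite I\<close> that by (intro arg_min_least) auto
    then have "blinfun_apply m \<in> ?A 0 \<inter> (\<Inter>f'\<in>I. ?A f')" by blast
    then show "?A 0 \<inter> (\<Inter>f'\<in>I. ?A f') \<noteq> {}" by blast
  qed
  then obtain g where g: "\<And>f'. g \<in> ?A f'" by auto
  from g[of 0] obtain f where f: "g = blinfun_apply f" by blast
  have "?F f \<le> ?F f'" for f'
    using g[of f'] unfolding f by (auto simp: blinfun_apply_inject)
  then show ?thesis by blast
qed

section \<open>Differentiability of the conjugate at a strong maximum\<close>

text \<open>
  Let \<open>f\<close> move towards \<open>f'\<close> by a vanishing fraction \<open>t n\<close>, and let \<open>u n\<close> be a maximum point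
  for the moved functional. The sequence \<open>u\<close> is maximising for \<open>f\<close> itself, so it converges to
  \<open>z\<close>. Minimality of \<open>f\<close>, divided by \<open>t n\<close>, gives the claim with \<open>u n\<close> in place of \<open>z\<close> in
  the linear term \<open>f' - f\<close>, and the limit gives the claim.
\<close>

lemma first_order_at_minimiser:
  fixes f f' :: "'a::real_normed_vector \<Rightarrow>\<^sub>L real"
    and S :: "'a set"
  assumes bnd: "bounded S"
    and attained: "\<And>f' :: 'a \<Rightarrow>\<^sub>L real. \<exists>x\<in>S. \<forall>y\<in>S. (1/2) * (norm y)\<^sup>2 + f' y \<le> (1/2) * (norm x)\<^sup>2 + f' x"
    and min: "\<And>f'. (1/2) * (norm f)\<^sup>2 + conj_sup S f \<le> (1/2) * (norm f')\<^sup>2 + conj_sup S f'"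
    and strong: "\<And>u :: nat \<Rightarrow> 'a. (\<And>n. u n \<in> S) \<Longrightarrow>
        (\<lambda>n. (1/2) * (norm (u n))\<^sup>2 + f (u n)) \<longlonglongrightarrow> conj_sup S f \<Longrightarrow> u \<longlonglongrightarrow> z"
  shows "(1/2) * (norm f)\<^sup>2 + f z \<le> (1/2) * (norm f')\<^sup>2 + f' z"
proof -
  have ne: "S \<noteq> {}" using attained by blast
  define d where "d = f' - f"
  define t where "t = (\<lambda>n. 1 / real (Suc n))"
  have t: "0 < t n" "t n \<le> 1" for n by (auto simp: t_def)
  have t0: "t \<longlonglongrightarrow> 0" unfolding t_def by (rule LIMSEQ_Suc[OF lim_1_over_n])
  have "\<exists>x\<in>S. \<forall>y\<in>S. (1/2) * (norm y)\<^sup>2 + (f + t n *\<^sub>R d) y \<le> (1/2) * (norm x)\<^sup>2 + (f + t n *\<^sub>R d) x" for n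
    by (rule attained)
  then obtain u where u: "\<And>n. u n \<in> S"
    and max: "\<And>n y. y \<in> S \<Longrightarrow> (1/2) * (norm y)\<^sup>2 + (f + t n *\<^sub>R d) y \<le> (1/2) * (norm (u n))\<^sup>2 + (f + t n *\<^sub>R d) (u n)"
    by metis
  have val: "conj_sup S (f + t n *\<^sub>R d) = (1/2) * (norm (u n))\<^sup>2 + f (u n) + t n * d (u n)" for n
  proof (rule antisym)
    show "conj_sup S (f + t n *\<^sub>R d) \<le> (1/2) * (norm (u n))\<^sup>2 + f (u n) + t n * d (u n)"
      using max[of _ n] by (simp add: conj_sup_le_iff[OF ne bnd] blinfun.add_left blinfun.scaleR_left add.assoc)
    show "(1/2) * (norm (u n))\<^sup>2 + f (u n) + t n * d (u n) \<le> conj_sup S (f + t n *\<^sub>R d)"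
      using conj_sup_upper[OF bnd u, of n "f + t n *\<^sub>R d"] by (simp add: blinfun.add_left blinfun.scaleR_left)
  qed
  obtain B where B: "\<And>x. x \<in> S \<Longrightarrow> norm x \<le> B" using bnd by (auto simp: bounded_iff)
  have dB: "\<bar>d x\<bar> \<le> norm d * B" if "x \<in> S" for x
    using norm_blinfun[of d x] mult_left_mono[OF B[OF that], of "norm d"] by simp
  have lower: "conj_sup S f - 2 * (norm d * B) * t n \<le> (1/2) * (norm (u n))\<^sup>2 + f (u n)" for n
  proof -
    have "conj_sup S f \<le> conj_sup S (f + t n *\<^sub>R d) + t n * (norm d * B)"
      unfolding conj_sup_le_iff[OF ne bnd]
    proof
      fix x assume "x \<in> S"
      have "- (t n * (norm d * B)) \<le> t n * d x"
        using mult_left_mono[of "- (norm d * B)" "d x" "t n"] dB[OF \<open>x \<in> S\<close>] t(1)[of n] by (simp add: abs_le_iff)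
      with conj_sup_upper[OF bnd \<open>x \<in> S\<close>, of "f + t n *\<^sub>R d"]
      show "(1/2) * (norm x)\<^sup>2 + f x \<le> conj_sup S (f + t n *\<^sub>R d) + t n * (norm d * B)"
        by (simp add: blinfun.add_left blinfun.scaleR_left)
    qed
    moreover have "t n * d (u n) \<le> t n * (norm d * B)"
      using dB[OF u[of n]] t(1)[of n] by (intro mult_left_mono) auto
    ultimately show ?thesis unfolding val by (simp add: algebra_simps)
  qed
  have "(\<lambda>n. (1/2) * (norm (u n))\<^sup>2 + f (u n)) \<longlonglongrightarrow> conj_sup S f"
  proof (rule tendsto_sandwich[OF _ _ _ tendsto_const])
    have "(\<lambda>n. conj_sup S f - 2 * (norm d * B) * t n) \<longlonglongrightarrow> conj_sup S f - 2 * (norm d * B) * 0"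
      by (intro tendsto_intros t0)
    then show "(\<lambda>n. conj_sup S f - 2 * (norm d * B) * t n) \<longlonglongrightarrow> conj_sup S f" by simp
  qed (use lower conj_sup_upper[OF bnd u, of _ f] in auto)
  with u have "u \<longlonglongrightarrow> z" by (rule strong)
  \<comment> \<open>convexity of the squared norm makes the increment of its half at most linear in \<open>t n\<close>\<close>
  have "0 \<le> (1/2) * (norm f')\<^sup>2 - (1/2) * (norm f)\<^sup>2 + d (u n)" for n
  proof -
    have "f + t n *\<^sub>R d = (1 - t n) *\<^sub>R f + t n *\<^sub>R f'" by (simp add: d_def algebra_simps)
    then have "norm (f + t n *\<^sub>R d) \<le> (1 - t n) * norm f + t n * norm f'"
      using norm_triangle_ineq[of "(1 - t n) *\<^sub>R f" "t n *\<^sub>R f'"] t[of n] by simp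
    then have "(norm (f + t n *\<^sub>R d))\<^sup>2 \<le> ((1 - t n) * norm f + t n * norm f')\<^sup>2"
      by (rule power_mono) simp
    also have "\<dots> = (1 - t n) * (norm f)\<^sup>2 + t n * (norm f')\<^sup>2 - t n * (1 - t n) * (norm f - norm f')\<^sup>2"
      by (simp add: power2_eq_square algebra_simps)
    also have "\<dots> \<le> (1 - t n) * (norm f)\<^sup>2 + t n * (norm f')\<^sup>2"
      using t[of n] by simp
    finally have conv: "(norm (f + t n *\<^sub>R d))\<^sup>2 \<le> (1 - t n) * (norm f)\<^sup>2 + t n * (norm f')\<^sup>2" .
    have "(1/2) * (norm f)\<^sup>2 + conj_sup S f \<le> (1/2) * (norm (f + t n *\<^sub>R d))\<^sup>2 + conj_sup S (f + t n *\<^sub>R d)"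
      by (rule min)
    with conv val[of n] conj_sup_upper[OF bnd u, of n f]
    have "0 \<le> t n * ((1/2) * (norm f')\<^sup>2 - (1/2) * (norm f)\<^sup>2 + d (u n))"
      by (simp add: algebra_simps)
    then show ?thesis using t(1)[of n] by (simp add: zero_le_mult_iff)
  qed
  moreover have "(\<lambda>n. (1/2) * (norm f')\<^sup>2 - (1/2) * (norm f)\<^sup>2 + d (u n))
      \<longlonglongrightarrow> (1/2) * (norm f')\<^sup>2 - (1/2) * (norm f)\<^sup>2 + d z"
    by (intro tendsto_intros \<open>u \<longlonglongrightarrow> z\<close>)
  ultimately have "0 \<le> (1/2) * (norm f')\<^sup>2 - (1/2) * (norm f)\<^sup>2 + d z"
    by (intro LIMSEQ_le_const) auto
  then show ?thesis by (simp add: d_def blinfun.diff_left)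
qed

section \<open>Bounded sets with strong maxima are singletons\<close>

theorem corollary3:
  fixes S :: "'a::banach set"
  assumes "S \<noteq> {}" and "closed S" and "bounded S"
  shows "(\<forall>f :: 'a \<Rightarrow>\<^sub>L real.
            attains_strong_maximum (\<lambda>x. (1/2) * (norm x)\<^sup>2 + blinfun_apply f x) S)
         \<longleftrightarrow> is_singleton S"
proof
  assume "is_singleton S"
  then obtain a where "S = {a}" by (rule is_singletonE)
  moreover have "u = (\<lambda>n. a)" if "\<forall>n. u n = a" for u :: "nat \<Rightarrow> 'a" using that by auto
  ultimately show "\<forall>f :: 'a \<Rightarrow>\<^sub>L real. attains_strong_maximum (\<lambda>x. (1/2) * (norm x)\<^sup>2 + f x) S"
    unfolding attains_strong_maximum_def by auto
next
  assume strong: "\<forall>f :: 'a \<Rightarrow>\<^sub>L real. attains_strong_maximum (\<lambda>x. (1/2) * (norm x)\<^sup>2 + f x) S"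
  obtain f where min: "\<And>f'. (1/2) * (norm f)\<^sup>2 + conj_sup S f \<le> (1/2) * (norm f')\<^sup>2 + conj_sup S f'"
    using minimiser_exists[OF assms(1,3)] by blast
  obtain z where "z \<in> S" and max: "\<And>y. y \<in> S \<Longrightarrow> (1/2) * (norm y)\<^sup>2 + f y \<le> (1/2) * (norm z)\<^sup>2 + f z"
    and lim: "\<And>u :: nat \<Rightarrow> 'a. (\<And>n. u n \<in> S) \<Longrightarrow>
        (\<lambda>n. (1/2) * (norm (u n))\<^sup>2 + f (u n)) \<longlonglongrightarrow> conj_sup S f \<Longrightarrow> u \<longlonglongrightarrow> z"
    using strong[rule_format, of f] unfolding attains_strong_maximum_def conj_sup_def by blast
  have crit: "(1/2) * (norm f)\<^sup>2 + f z \<le> (1/2) * (norm f')\<^sup>2 + f' z" for f' :: "'a \<Rightarrow>\<^sub>L real"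
    using strong unfolding attains_strong_maximum_def
    by (intro first_order_at_minimiser[OF assms(3) _ min lim]) blast+
  \<comment> \<open>the functional \<open>- (norm z *\<^sub>R e)\<close> attains the minimum \<open>- (1/2) * (norm z)\<^sup>2\<close> of the right-hand side of \<open>crit\<close>\<close>
  obtain e :: "'a \<Rightarrow>\<^sub>L real" where e: "norm e \<le> 1" "e z = norm z"
    using norming_functional_exists by blast
  have "norm (- (norm z *\<^sub>R e)) \<le> norm z"
    using mult_left_mono[OF e(1), of "norm z"] by simp
  then have dual_norm: "(norm (- (norm z *\<^sub>R e)))\<^sup>2 \<le> (norm z)\<^sup>2" by (rule power_mono) simp
  have dual_val: "(- (norm z *\<^sub>R e)) z = - (norm z)\<^sup>2"
    by (simp add: blinfun.minus_left blinfun.scaleR_left e(2) power2_eq_square)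
  have nonpos: "(1/2) * (norm f)\<^sup>2 + ((1/2) * (norm z)\<^sup>2 + f z) \<le> 0"
    using crit[of "- (norm z *\<^sub>R e)"] dual_norm unfolding dual_val by argo
  \<comment> \<open>Fenchel-Young at \<open>- y\<close> is the lower bound that meets the upper bound given by \<open>nonpos\<close>\<close>
  have const: "(1/2) * (norm y)\<^sup>2 + f y = - ((1/2) * (norm f)\<^sup>2)" if "y \<in> S" for y
    using half_norm_sq_ge[of f "- y"] max[OF that] nonpos by (simp add: blinfun.minus_right)
  have "conj_sup S f = - ((1/2) * (norm f)\<^sup>2)"
    unfolding conj_sup_def using const assms(1) by simp
  \<comment> \<open>the constant sequence at any \<open>y \<in> S\<close> is a maximising sequence\<close>
  then have "y = z" if "y \<in> S" for y
    using lim[of "\<lambda>n. y"] that const[OF that] by (simp add: LIMSEQ_const_iff)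
  with \<open>z \<in> S\<close> have "S = {z}" by blast
  then show "is_singleton S" by (simp add: is_singleton_def)
qed

end
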